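(* (AMDCT VI) Let $n,N$ be positive integers. For all $k,k'\in D_N^-$, $$\sum_{s\in F_N^{\mathrm{VI},-}}\widetilde{\varepsilon}_s\cos_k^-(s)\cos_{k'}^-(s)=d_k^{-1}\left(\frac{2N-1}{4}\right)^n\delta_{kk'}.$$ Consequently any function $f:F_N^{\mathrm{VI},-}\to\mathbb{R}$ can be expanded, for all $s\in F_N^{\mathrm{VI},-}$, as $$f(s)=\sum_{k\in D_N^-}A_k\cos^-_k(s)\quad\text{with}\quad A_k=d_k\left(\frac{4}{2N-1}\right)^n\sum_{s\in F_N^{\mathrm{VI},-}}\widetilde{\varepsilon}_s f(s)\cos_k^-(s).$$
   Context: For $\lambda,x\in\mathbb{R}^n$, the antisymmetric cosine function is $\cos^-_\lambda(x)=\sum_{\sigma\in S_n}\mathrm{sgn}(\sigma)\prod_{i=1}^n\cos(\pi\lambda_{\sigma(i)}x_i)$. For fixed $N$, put $c_r=\frac12$ if $r=0$ or $r=N$, and $c_r=1$ otherwise. Let $D_N=\{(k_1,\dots,k_n)\in\mathbb{Z}^n : 0\le k_i\le N-1,\ i=1,\dots,n\}$ and $D_N^-=\{k\in D_N : k_1>k_2>\dots>k_n\}$. For $k\in D_N$, $d_k=c_{k_1}\cdots c_{k_n}$. The grid is $F_N^{\mathrm{VI},-}=\left\{\left(\frac{2(r_1+\frac12)}{2N-1},\dots,\frac{2(r_n+\frac12)}{2N-1}\right) : (r_1,\dots,r_n)\in D_N^-\right\}$, and for $s=\left(\frac{2(r_1+\frac12)}{2N-1},\dots,\frac{2(r_n+\frac12)}{2N-1}\right)$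 in it, $\widetilde{\varepsilon}_s=c_{r_1+1}\cdots c_{r_n+1}$. *)

theory Defs
  imports Complex_Main "HOL-Library.FuncSet" "HOL-Combinatorics.Permutations"
begin

text \<open>
  An n-tuple is a function on the index set \<open>{1..n}\<close>. Tuples of integers and grid points are
  taken extensional (equal to \<open>undefined\<close> outside \<open>{1..n}\<close>), so that equality of functions is
  equality of tuples and the sets of tuples below are finite.
\<close>

definition cos_minus :: "nat \<Rightarrow> (nat \<Rightarrow> real) \<Rightarrow> (nat \<Rightarrow> real) \<Rightarrow> real" where
  "cos_minus n l x =
     (\<Sum>\<sigma> | \<sigma> permutes {1..n}. real_of_int (sign \<sigma>) * (\<Prod>i=1..n. cos (pi * l (\<sigma> i) * x i)))"

definition c :: "nat \<Rightarrow> int \<Rightarrow> real" where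
  "c N r = (if r = 0 \<or> r = int N then 1 / 2 else 1)"

definition D :: "nat \<Rightarrow> nat \<Rightarrow> (nat \<Rightarrow> int) set" where
  "D n N = {1..n} \<rightarrow>\<^sub>E {0..int N - 1}"

definition D_minus :: "nat \<Rightarrow> nat \<Rightarrow> (nat \<Rightarrow> int) set" where
  "D_minus n N = {k \<in> D n N. \<forall>i\<in>{1..n}. \<forall>j\<in>{1..n}. i < j \<longrightarrow> k i > k j}"

definition d :: "nat \<Rightarrow> nat \<Rightarrow> (nat \<Rightarrow> int) \<Rightarrow> real" where
  "d n N k = (\<Prod>i=1..n. c N (k i))"

definition grid_point :: "nat \<Rightarrow> nat \<Rightarrow> (nat \<Rightarrow> int) \<Rightarrow> (nat \<Rightarrow> real)" where
  "grid_point n N r = (\<lambda>i\<in>{1..n}. 2 * (real_of_int (r i) + 1 / 2) / (2 * real N - 1))"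

definition F_VI_minus :: "nat \<Rightarrow> nat \<Rightarrow> (nat \<Rightarrow> real) set" where
  "F_VI_minus n N = grid_point n N ` D_minus n N"

text \<open>
  The weight is a function of the grid point \<open>s\<close>, through the unique \<open>r\<close> that it comes from;
  see \<open>eps_tilde_grid_point\<close>.
\<close>

definition eps_tilde :: "nat \<Rightarrow> nat \<Rightarrow> (nat \<Rightarrow> real) \<Rightarrow> real" where
  "eps_tilde n N s =
     (let r = the_inv_into (D_minus n N) (grid_point n N) s in \<Prod>i=1..n. c N (r i + 1))"

lemma inj_on_grid_point: "inj_on (grid_point n N) (D_minus n N)"
proof (rule inj_onI)
  fix r r' assume r: "r \<in> D_minus n N" and r': "r' \<in> D_minus n N"
    and eq: "grid_point n N r = grid_point n N r'"
  have nz: "2 * real N - 1 \<noteq> 0"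
  proof
    assume "2 * real N - 1 = 0"
    then have "real (2 * N) = real 1" by simp
    then have "2 * N = 1" by (simp only: of_nat_eq_iff)
    then show False by presburger
  qed
  have "r i = r' i" if "i \<in> {1..n}" for i
    using fun_cong[OF eq, of i] that nz by (simp add: grid_point_def)
  then show "r = r'"
    using r r' unfolding D_minus_def D_def by (auto intro: PiE_ext)
qed

lemma eps_tilde_grid_point:
  assumes "r \<in> D_minus n N"
  shows "eps_tilde n N (grid_point n N r) = (\<Prod>i=1..n. c N (r i + 1))"
  using the_inv_into_f_f[OF inj_on_grid_point assms] by (simp add: eps_tilde_def)

end

theory Submission
  imports Defs
begin

text \<open>
  Put \<open>M = 2 N - 1\<close>. The functions \<open>cos\<^sup>-\<close> are determinants of the one-dimensional kernel
  \<open>\<phi> a b = cos (\<pi> a (2 b + 1) / M)\<close>, and a discrete form of the Andreief (Cauchy--Binet) identity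
  reduces orthogonality of determinants over decreasing tuples to orthogonality of the kernel:
  summing a product of two determinants over decreasing tuples is the same as summing one determinant
  times one diagonal product over \<^emph>\<open>all\<close> tuples, and the latter sum factorises coordinatewise
  (\<open>sum_alt_mult_alt\<close>). For strictly decreasing indices only the identity permutation contributes
  (\<open>alt_orthogonal\<close>).

  The kernel becomes symmetric when the grid is run through backwards:
  \<open>\<phi> k (N - 1 - j) = (-1)\<^sup>k cos (2 \<pi> k j / M)\<close>. The same reversal turns the weight
  \<open>c (r + 1)\<close> into \<open>c j\<close>, so one computation, a Dirichlet kernel vanishing at the points
  \<open>2 \<pi> m / M\<close> (\<open>sum_cos_cos\<close>), gives orthogonality of the rows as well as of the columns of
  \<open>\<phi>\<close>. Orthogonality of the rows is the first claim. Orthogonality of the columns is completeness,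
  and gives the expansion after the two summations have been exchanged.
\<close>

section \<open>Decreasing tuples and sorting permutations\<close>

definition decr_tuples :: "nat \<Rightarrow> 'a::linorder set \<Rightarrow> (nat \<Rightarrow> 'a) set" where
  "decr_tuples n S = {k \<in> {1..n} \<rightarrow>\<^sub>E S. \<forall>i\<in>{1..n}. \<forall>j\<in>{1..n}. i < j \<longrightarrow> k i > k j}"

lemma decr_tuples_less_iff:
  assumes "k \<in> decr_tuples n S" "i \<in> {1..n}" "j \<in> {1..n}"
  shows "k i < k j \<longleftrightarrow> j < i"
proof -
  have "\<And>i j. \<lbrakk>i \<in> {1..n}; j \<in> {1..n}; i < j\<rbrakk> \<Longrightarrow> k j < k i"
    using assms(1) unfolding decr_tuples_def by blast
  from this[of i j] this[of j i] show ?thesis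
    using assms(2,3) by (metis less_asym less_irrefl linorder_neqE_nat)
qed

lemma decr_tuples_inj_on: "k \<in> decr_tuples n S \<Longrightarrow> inj_on k {1..n}"
  by (rule inj_onI) (metis decr_tuples_less_iff less_irrefl linorder_neqE_nat)

lemma finite_decr_tuples: "finite S \<Longrightarrow> finite (decr_tuples n S)"
  unfolding decr_tuples_def by (rule finite_subset[OF _ finite_PiE[of "{1..n}" "\<lambda>_. S"]]) auto

lemma PiE_comp_permutes:
  assumes "r \<in> I \<rightarrow>\<^sub>E S" "\<tau> permutes I"
  shows "r \<circ> \<tau> \<in> I \<rightarrow>\<^sub>E S"
proof (rule PiE_I)
  fix i
  show "(r \<circ> \<tau>) i \<in> S" if "i \<in> I"
    using that assms permutes_in_image[OF assms(2)] by auto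
  show "(r \<circ> \<tau>) i = undefined" if "i \<notin> I"
    using that assms permutes_not_in[OF assms(2)] by auto
qed

text \<open>
  A permutation relating two strictly decreasing tuples is itself increasing, hence satisfies
  \<open>i \<le> \<rho> i\<close> throughout.
\<close>

lemma decr_tuples_permuted:
  assumes k: "k \<in> decr_tuples n S" and l: "l \<in> decr_tuples n S'"
    and \<rho>: "\<rho> permutes {1..n}" and eq: "\<And>i. i \<in> {1..n} \<Longrightarrow> k (\<rho> i) = l i"
  shows "\<rho> = id"
proof -
  have mono: "\<rho> i < \<rho> j" if "i \<in> {1..n}" "j \<in> {1..n}" "i < j" for i j
    using that decr_tuples_less_iff[OF l, of j i] eq[of i] eq[of j]
      decr_tuples_less_iff[OF k, of "\<rho> j" "\<rho> i"] permutes_in_image[OF \<rho>] by auto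
  have "i \<le> \<rho> i" if "i \<in> {1..n}" for i
    using that
  proof (induction i)
    case (Suc i)
    show ?case
    proof (cases "i = 0")
      case True
      then show ?thesis using Suc.prems permutes_in_image[OF \<rho>, of "Suc i"] by simp
    next
      case False
      then show ?thesis using Suc mono[of i "Suc i"] by simp
    qed
  qed simp
  then show ?thesis by (intro permutes_natset_ge[OF \<rho>]) auto
qed

text \<open>The sorting permutation sends an index to the rank of its entry, counted from the top.\<close>

lemma ex_sorting_permutation:
  assumes r: "r \<in> {1..n} \<rightarrow>\<^sub>E S" and inj: "inj_on r {1..n}"
  obtains r0 \<tau> where "r0 \<in> decr_tuples n S" "\<tau> permutes {1..n}" "r = r0 \<circ> \<tau>"
proof -
  define rank where "rank i = card {j\<in>{1..n}. r i \<le> r j}" for i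
  have rank_less: "rank i < rank j" if "i \<in> {1..n}" "j \<in> {1..n}" "r j < r i" for i j
  proof -
    have "j \<in> {l\<in>{1..n}. r j \<le> r l} - {l\<in>{1..n}. r i \<le> r l}"
      using that by auto
    moreover have "{l\<in>{1..n}. r i \<le> r l} \<subseteq> {l\<in>{1..n}. r j \<le> r l}"
      using that by auto
    ultimately show ?thesis
      unfolding rank_def by (intro psubset_card_mono) auto
  qed
  have inj_rank: "inj_on rank {1..n}"
  proof (rule inj_onI)
    fix i j assume *: "i \<in> {1..n}" "j \<in> {1..n}" "rank i = rank j"
    then have "r i = r j"
      using rank_less[of i j] rank_less[of j i] by (metis less_irrefl linorder_neqE)
    with * inj show "i = j" by (auto dest: inj_onD)
  qed
  have "rank i \<in> {1..n}" if "i \<in> {1..n}" for i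
  proof -
    have "rank i \<le> card {1..n}"
      unfolding rank_def by (rule card_mono) auto
    moreover have "rank i > 0"
      unfolding rank_def using that by (auto simp: card_gt_0_iff)
    ultimately show ?thesis by simp
  qed
  then have bij: "bij_betw rank {1..n} {1..n}"
    using endo_inj_surj[OF _ _ inj_rank] inj_rank by (auto simp: bij_betw_def image_subset_iff)
  define \<tau> where "\<tau> = (\<lambda>i. if i \<in> {1..n} then rank i else i)"
  have \<tau>: "\<tau> permutes {1..n}"
  proof (rule bij_imp_permutes)
    show "bij_betw \<tau> {1..n} {1..n}"
      using bij by (rule iffD1[OF bij_betw_cong, rotated]) (simp add: \<tau>_def)
  qed (auto simp: \<tau>_def)
  note inv = permutes_inv[OF \<tau>]
  have "r (inv \<tau> j) < r (inv \<tau> i)" if "i \<in> {1..n}" "j \<in> {1..n}" "i < j" for i j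
  proof (rule ccontr)
    have in_I: "inv \<tau> i \<in> {1..n}" "inv \<tau> j \<in> {1..n}"
      using that permutes_in_image[OF inv] by blast+
    have \<tau>_inv: "\<tau> (inv \<tau> l) = l" for l using permutes_inverses(1)[OF \<tau>] .
    assume "\<not> r (inv \<tau> j) < r (inv \<tau> i)"
    moreover have "r (inv \<tau> j) \<noteq> r (inv \<tau> i)"
      using that \<tau>_inv in_I inj by (metis inj_onD less_irrefl)
    ultimately have "rank (inv \<tau> j) < rank (inv \<tau> i)"
      using in_I by (intro rank_less) auto
    then have "\<tau> (inv \<tau> j) < \<tau> (inv \<tau> i)" using in_I by (simp add: \<tau>_def)
    then show False using that by (simp add: \<tau>_inv)
  qed
  then have "r \<circ> inv \<tau> \<in> decr_tuples n S"
    unfolding decr_tuples_def using PiE_comp_permutes[OF r inv] by simp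
  moreover have "r = (r \<circ> inv \<tau>) \<circ> \<tau>"
    using permutes_inv_o(2)[OF \<tau>] by (simp add: comp_assoc)
  ultimately show ?thesis using \<tau> that by blast
qed

text \<open>
  Permutations of the positions act freely on the injective tuples, and the decreasing tuples
  represent the orbits.
\<close>

lemma sum_PiE_decr_tuples:
  fixes F :: "(nat \<Rightarrow> 'a::linorder) \<Rightarrow> 'b::comm_monoid_add"
  assumes fin: "finite S"
    and zero: "\<And>r. \<lbrakk>r \<in> {1..n} \<rightarrow>\<^sub>E S; \<not> inj_on r {1..n}\<rbrakk> \<Longrightarrow> F r = 0"
  shows "(\<Sum>r\<in>{1..n} \<rightarrow>\<^sub>E S. F r) = (\<Sum>r\<in>decr_tuples n S. \<Sum>\<tau> | \<tau> permutes {1..n}. F (r \<circ> \<tau>))"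
proof -
  let ?P = "{\<tau>. \<tau> permutes {1..n}}"
  let ?J = "{r \<in> {1..n} \<rightarrow>\<^sub>E S. inj_on r {1..n}}"
  let ?h = "\<lambda>(r, \<tau>). r \<circ> \<tau>"
  have inj: "inj_on ?h (decr_tuples n S \<times> ?P)"
  proof (intro inj_onI, clarify)
    fix r \<tau> r' \<tau>'
    assume r: "r \<in> decr_tuples n S" and r': "r' \<in> decr_tuples n S"
      and \<tau>: "\<tau> permutes {1..n}" and \<tau>': "\<tau>' permutes {1..n}" and eq: "r \<circ> \<tau> = r' \<circ> \<tau>'"
    let ?\<rho> = "\<tau> \<circ> inv \<tau>'"
    have "r \<circ> ?\<rho> = r' \<circ> (\<tau>' \<circ> inv \<tau>')"
      using eq by (simp add: comp_assoc[symmetric])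
    then have eq': "r \<circ> ?\<rho> = r'"
      using permutes_inv_o(1)[OF \<tau>'] by simp
    have "?\<rho> = id"
    proof (rule decr_tuples_permuted[OF r r'])
      show "?\<rho> permutes {1..n}" using \<tau> \<tau>' by (simp add: permutes_compose permutes_inv)
    qed (use fun_cong[OF eq'] in simp)
    moreover from this have "\<tau> = \<tau>'"
      using permutes_inv_o(2)[OF \<tau>'] by (metis comp_assoc comp_id id_comp)
    ultimately show "r = r' \<and> \<tau> = \<tau>'" using eq' by simp
  qed
  have "?h ` (decr_tuples n S \<times> ?P) = ?J"
  proof
    show "?h ` (decr_tuples n S \<times> ?P) \<subseteq> ?J"
    proof clarify
      fix r \<tau> assume r: "r \<in> decr_tuples n S" and \<tau>: "\<tau> permutes {1..n}"
      have "inj_on (r \<circ> \<tau>) {1..n}"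
        using decr_tuples_inj_on[OF r] \<tau>
        by (intro comp_inj_on) (auto simp: permutes_inj_on permutes_image)
      moreover have "r \<circ> \<tau> \<in> {1..n} \<rightarrow>\<^sub>E S"
        using r \<tau> by (intro PiE_comp_permutes) (auto simp: decr_tuples_def)
      ultimately show "r \<circ> \<tau> \<in> {1..n} \<rightarrow>\<^sub>E S \<and> inj_on (r \<circ> \<tau>) {1..n}" by simp
    qed
    show "?J \<subseteq> ?h ` (decr_tuples n S \<times> ?P)"
    proof
      fix r assume "r \<in> ?J"
      then obtain r0 \<tau> where "r0 \<in> decr_tuples n S" "\<tau> permutes {1..n}" "r = r0 \<circ> \<tau>"
        using ex_sorting_permutation by blast
      then show "r \<in> ?h ` (decr_tuples n S \<times> ?P)"
        by (intro image_eqI[of _ _ "(r0, \<tau>)"]) auto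
    qed
  qed
  then have "sum F ?J = (\<Sum>x\<in>decr_tuples n S \<times> ?P. F (?h x))"
    using sum.reindex[OF inj, of F] by (simp add: comp_def)
  also have "\<dots> = (\<Sum>r\<in>decr_tuples n S. \<Sum>\<tau>\<in>?P. F (r \<circ> \<tau>))"
    by (simp add: sum.cartesian_product case_prod_unfold)
  also have "sum F ?J = sum F ({1..n} \<rightarrow>\<^sub>E S)"
    using fin zero by (intro sum.mono_neutral_left) (auto intro: finite_PiE)
  finally show ?thesis .
qed

section \<open>Orthogonality of determinants\<close>

text \<open>The determinant of the matrix with entries \<open>\<phi> (k i) (r j)\<close>, by the Leibniz formula.\<close>

definition alt :: "nat \<Rightarrow> ('a \<Rightarrow> 'b \<Rightarrow> real) \<Rightarrow> (nat \<Rightarrow> 'a) \<Rightarrow> (nat \<Rightarrow> 'b) \<Rightarrow> real" where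
  "alt n \<phi> k r = (\<Sum>\<sigma> | \<sigma> permutes {1..n}. of_int (sign \<sigma>) * (\<Prod>i=1..n. \<phi> (k (\<sigma> i)) (r i)))"

lemma alt_transpose: "alt n \<phi> k r = alt n (\<lambda>b a. \<phi> a b) r k"
proof -
  have "alt n \<phi> k r =
      (\<Sum>\<sigma> | \<sigma> permutes {1..n}. of_int (sign (inv \<sigma>)) * (\<Prod>i=1..n. \<phi> (k (inv \<sigma> i)) (r i)))"
    unfolding alt_def by (rule sum_permutations_inverse)
  also have "\<dots> = alt n (\<lambda>b a. \<phi> a b) r k"
    unfolding alt_def
  proof (rule sum.cong[OF refl])
    fix \<sigma> assume "\<sigma> \<in> {\<sigma>. \<sigma> permutes {1..n}}"
    then have \<sigma>: "\<sigma> permutes {1..n}" by simp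
    have "(\<Prod>i=1..n. \<phi> (k (inv \<sigma> i)) (r i)) = (\<Prod>i=1..n. \<phi> (k (inv \<sigma> (\<sigma> i))) (r (\<sigma> i)))"
      using prod.permute[OF \<sigma>, of "\<lambda>i. \<phi> (k (inv \<sigma> i)) (r i)"] by (simp add: comp_def)
    moreover have "sign (inv \<sigma>) = sign \<sigma>"
      using \<sigma> by (intro sign_inverse) (auto simp: permutation_permutes)
    ultimately show "of_int (sign (inv \<sigma>)) * (\<Prod>i=1..n. \<phi> (k (inv \<sigma> i)) (r i)) =
        of_int (sign \<sigma>) * (\<Prod>i=1..n. \<phi> (k i) (r (\<sigma> i)))"
      using permutes_inverses(2)[OF \<sigma>] by simp
  qed
  finally show ?thesis .
qed

lemma alt_permute_left:
  assumes \<tau>: "\<tau> permutes {1..n}"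
  shows "alt n \<phi> (k \<circ> \<tau>) r = of_int (sign \<tau>) * alt n \<phi> k r"
proof -
  have "alt n \<phi> k r = (\<Sum>\<sigma> | \<sigma> permutes {1..n}.
      of_int (sign (\<tau> \<circ> \<sigma>)) * (\<Prod>i=1..n. \<phi> (k ((\<tau> \<circ> \<sigma>) i)) (r i)))"
    unfolding alt_def by (rule setum_permutations_compose_left[OF \<tau>])
  also have "\<dots> = (\<Sum>\<sigma> | \<sigma> permutes {1..n}.
      of_int (sign \<tau>) * (of_int (sign \<sigma>) * (\<Prod>i=1..n. \<phi> ((k \<circ> \<tau>) (\<sigma> i)) (r i))))"
  proof (rule sum.cong[OF refl])
    fix \<sigma> assume "\<sigma> \<in> {\<sigma>. \<sigma> permutes {1..n}}"
    then have "sign (\<tau> \<circ> \<sigma>) = sign \<tau> * sign \<sigma>"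
      using \<tau> by (intro sign_compose) (auto simp: permutation_permutes)
    then show "of_int (sign (\<tau> \<circ> \<sigma>)) * (\<Prod>i=1..n. \<phi> (k ((\<tau> \<circ> \<sigma>) i)) (r i)) =
      of_int (sign \<tau>) * (of_int (sign \<sigma>) * (\<Prod>i=1..n. \<phi> ((k \<circ> \<tau>) (\<sigma> i)) (r i)))" by simp
  qed
  also have "\<dots> = of_int (sign \<tau>) * alt n \<phi> (k \<circ> \<tau>) r"
    unfolding alt_def by (simp add: sum_distrib_left)
  finally have "of_int (sign \<tau>) * alt n \<phi> k r =
      of_int (sign \<tau> * sign \<tau>) * alt n \<phi> (k \<circ> \<tau>) r"
    by (simp only: of_int_mult mult.assoc)
  then show ?thesis by (simp only: sign_idempotent of_int_1 mult_1_left)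
qed

lemma alt_permute_right:
  "\<tau> permutes {1..n} \<Longrightarrow> alt n \<phi> k (r \<circ> \<tau>) = of_int (sign \<tau>) * alt n \<phi> k r"
  using alt_permute_left[of \<tau> n "\<lambda>b a. \<phi> a b" r k] by (simp add: alt_transpose[of n \<phi>])

lemma alt_eq_0:
  assumes "\<not> inj_on r {1..n}"
  shows "alt n \<phi> k r = 0"
proof -
  from assms obtain i j where ij: "i \<in> {1..n}" "j \<in> {1..n}" "i \<noteq> j" "r i = r j"
    by (auto simp: inj_on_def)
  then have "r \<circ> Transposition.transpose i j = r"
    by (auto simp: fun_eq_iff Transposition.transpose_def)
  moreover have "Transposition.transpose i j permutes {1..n}"
    using ij by (intro permutes_swap_id)
  ultimately have "alt n \<phi> k r = - alt n \<phi> k r"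
    using alt_permute_right[of "Transposition.transpose i j" n \<phi> k r] ij(3)
    by (simp add: sign_swap_id)
  then show ?thesis by simp
qed

text \<open>
  The discrete Andreief identity: expanding the second determinant, each of its terms moves one
  permutation \<open>\<tau>\<close> onto the summation variable, where it is absorbed by the first determinant; the
  tuples \<open>r \<circ> \<tau>\<close> then exhaust all injective tuples, and on the others the first determinant vanishes.
\<close>

lemma sum_alt_mult_alt:
  fixes \<phi> :: "'a \<Rightarrow> 'b::linorder \<Rightarrow> real"
  assumes fin: "finite S"
  shows "(\<Sum>r\<in>decr_tuples n S. (\<Prod>i=1..n. w (r i)) * alt n \<phi> k r * alt n \<phi> l r) =
    (\<Sum>\<sigma> | \<sigma> permutes {1..n}.
       of_int (sign \<sigma>) * (\<Prod>i=1..n. \<Sum>s\<in>S. w s * \<phi> (k (\<sigma> i)) s * \<phi> (l i) s))"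
proof -
  define F where "F r = (\<Prod>i=1..n. w (r i)) * alt n \<phi> k r * (\<Prod>i=1..n. \<phi> (l i) (r i))" for r
  have "(\<Sum>\<tau> | \<tau> permutes {1..n}. F (r \<circ> \<tau>)) =
      (\<Prod>i=1..n. w (r i)) * alt n \<phi> k r * alt n \<phi> l r" for r
  proof -
    have "F (r \<circ> \<tau>) = (\<Prod>i=1..n. w (r i)) * alt n \<phi> k r *
        (of_int (sign \<tau>) * (\<Prod>i=1..n. \<phi> (l i) (r (\<tau> i))))" if "\<tau> permutes {1..n}" for \<tau>
      using prod.permute[OF that, of "\<lambda>i. w (r i)"]
      unfolding F_def alt_permute_right[OF that] by (simp add: comp_def)
    then have "(\<Sum>\<tau> | \<tau> permutes {1..n}. F (r \<circ> \<tau>)) = (\<Prod>i=1..n. w (r i)) * alt n \<phi> k r *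
        (\<Sum>\<tau> | \<tau> permutes {1..n}. of_int (sign \<tau>) * (\<Prod>i=1..n. \<phi> (l i) (r (\<tau> i))))"
      by (simp add: sum_distrib_left)
    also have "(\<Sum>\<tau> | \<tau> permutes {1..n}. of_int (sign \<tau>) * (\<Prod>i=1..n. \<phi> (l i) (r (\<tau> i)))) =
        alt n \<phi> l r"
      by (simp add: alt_transpose[of n \<phi>]) (simp add: alt_def)
    finally show ?thesis .
  qed
  then have "(\<Sum>r\<in>decr_tuples n S. (\<Prod>i=1..n. w (r i)) * alt n \<phi> k r * alt n \<phi> l r) =
      (\<Sum>r\<in>{1..n} \<rightarrow>\<^sub>E S. F r)"
    using sum_PiE_decr_tuples[OF fin, of n F] by (simp add: F_def alt_eq_0)
  also have "\<dots> = (\<Sum>r\<in>{1..n} \<rightarrow>\<^sub>E S. \<Sum>\<sigma> | \<sigma> permutes {1..n}.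
      of_int (sign \<sigma>) * (\<Prod>i=1..n. w (r i) * \<phi> (k (\<sigma> i)) (r i) * \<phi> (l i) (r i)))"
    by (simp add: F_def alt_def sum_distrib_left sum_distrib_right prod.distrib mult_ac)
  also have "\<dots> = (\<Sum>\<sigma> | \<sigma> permutes {1..n}. of_int (sign \<sigma>) *
      (\<Sum>r\<in>{1..n} \<rightarrow>\<^sub>E S. \<Prod>i=1..n. w (r i) * \<phi> (k (\<sigma> i)) (r i) * \<phi> (l i) (r i)))"
    by (subst sum.swap) (simp add: sum_distrib_left)
  also have "\<dots> = (\<Sum>\<sigma> | \<sigma> permutes {1..n}.
       of_int (sign \<sigma>) * (\<Prod>i=1..n. \<Sum>s\<in>S. w s * \<phi> (k (\<sigma> i)) s * \<phi> (l i) s))"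
    using fin by (simp add: prod_sum_PiE)
  finally show ?thesis .
qed

text \<open>
  By orthogonality of \<open>\<phi>\<close>, the term for \<open>\<sigma>\<close> survives only if \<open>k \<circ> \<sigma>\<close> agrees with \<open>l\<close> on \<open>{1..n}\<close>;
  both tuples decrease, so this forces \<open>\<sigma> = id\<close>.
\<close>

lemma alt_orthogonal:
  fixes \<phi> :: "'a::linorder \<Rightarrow> 'b::linorder \<Rightarrow> real"
  assumes fin: "finite S"
    and orth: "\<And>a b. \<lbrakk>a \<in> T; b \<in> T\<rbrakk> \<Longrightarrow>
                 (\<Sum>s\<in>S. w s * \<phi> a s * \<phi> b s) = (if a = b then h a else 0)"
    and k: "k \<in> decr_tuples n T" and l: "l \<in> decr_tuples n T"
  shows "(\<Sum>r\<in>decr_tuples n S. (\<Prod>i=1..n. w (r i)) * alt n \<phi> k r * alt n \<phi> l r) =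
    (if k = l then \<Prod>i=1..n. h (k i) else 0)"
proof -
  let ?G = "\<lambda>\<sigma>. of_int (sign \<sigma>) * (\<Prod>i=1..n. \<Sum>s\<in>S. w s * \<phi> (k (\<sigma> i)) s * \<phi> (l i) s)"
  have T: "k i \<in> T" "l i \<in> T" if "i \<in> {1..n}" for i
    using that k l by (auto simp: decr_tuples_def)
  have G: "?G \<sigma> = (if \<sigma> = id \<and> k = l then \<Prod>i=1..n. h (k i) else 0)"
    if \<sigma>: "\<sigma> permutes {1..n}" for \<sigma>
  proof -
    have *: "(\<Sum>s\<in>S. w s * \<phi> (k (\<sigma> i)) s * \<phi> (l i) s) =
        (if k (\<sigma> i) = l i then h (k (\<sigma> i)) else 0)" if "i \<in> {1..n}" for i
      using that T permutes_in_image[OF \<sigma>] by (intro orth) blast+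
    show ?thesis
    proof (cases "\<forall>i\<in>{1..n}. k (\<sigma> i) = l i")
      case True
      then have id: "\<sigma> = id" by (intro decr_tuples_permuted[OF k l \<sigma>]) auto
      moreover from this True have "k = l"
        using k l by (intro PiE_ext[of k "{1..n}" "\<lambda>_. T" l]) (auto simp: decr_tuples_def)
      ultimately show ?thesis using * by (simp add: sign_id)
    next
      case False
      then obtain i where i: "i \<in> {1..n}" "k (\<sigma> i) \<noteq> l i" by blast
      then have "(\<Prod>i=1..n. \<Sum>s\<in>S. w s * \<phi> (k (\<sigma> i)) s * \<phi> (l i) s) = 0"
        using *[OF i(1)] by (intro prod_zero bexI[of _ i]) auto
      then show ?thesis using False by auto
    qed
  qed
  have "(\<Sum>\<sigma> | \<sigma> permutes {1..n}. ?G \<sigma>) =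
      (\<Sum>\<sigma> | \<sigma> permutes {1..n}. if \<sigma> = id then (if k = l then \<Prod>i=1..n. h (k i) else 0) else 0)"
    by (intro sum.cong refl) (simp only: mem_Collect_eq G, auto)
  also have "\<dots> = (if k = l then \<Prod>i=1..n. h (k i) else 0)"
    by (simp add: sum.delta finite_permutations permutes_id)
  finally show ?thesis unfolding sum_alt_mult_alt[OF fin] .
qed

section \<open>The one-dimensional kernel\<close>

text \<open>Multiplied by \<open>2 sin a\<close>, the cosine sum telescopes.\<close>

lemma dirichlet_kernel:
  "2 * sin a * (\<Sum>j\<le>m. (if j = 0 then 1/2 else 1) * cos (2 * real j * a)) = sin ((2 * real m + 1) * a)"
proof (induction m)
  case (Suc m)
  have "sin ((2 * real (Suc m) + 1) * a) - sin ((2 * real m + 1) * a) =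
      2 * sin a * cos (2 * real (Suc m) * a)"
    using cos_times_sin[of "2 * real (Suc m) * a" a] by (simp add: algebra_simps)
  then show ?case using Suc by (simp add: algebra_simps)
qed simp

definition kern :: "nat \<Rightarrow> int \<Rightarrow> int \<Rightarrow> real" where
  "kern N a b = cos (pi * a * (2 * (b + 1/2) / (2 * real N - 1)))"

context
  fixes N :: nat
  assumes N: "N \<ge> 1"
begin

lemma c_eq: "r \<in> {0..int N - 1} \<Longrightarrow> c N r = (if r = 0 then 1/2 else 1)"
  by (auto simp: c_def)

lemma sum_cos:
  fixes m :: int
  shows "(\<Sum>r\<in>{0..int N - 1}. c N r * cos (2 * pi * m * r / (2 * real N - 1))) =
    (if (2 * int N - 1) dvd m then (2 * real N - 1) / 2 else 0)"
proof -
  define M where "M = 2 * real N - 1"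
  have M: "M > 0" using N by (simp add: M_def)
  define a where "a = pi * m / M"
  have Ma: "M * a = pi * m" using M by (simp add: a_def)
  obtain N' where N': "N = Suc N'" using N by (cases N) auto
  have sum: "(\<Sum>r\<in>{0..int N - 1}. c N r * cos (2 * pi * m * r / M)) =
      (\<Sum>j\<le>N'. (if j = 0 then 1/2 else 1) * cos (2 * real j * a))" (is "?L = _")
    by (rule sum.reindex_bij_witness[of _ int nat]) (auto simp: N' c_def a_def mult_ac)
  show ?thesis
  proof (cases "(2 * int N - 1) dvd m")
    case True
    then obtain q where q: "m = (2 * int N - 1) * q" by (elim dvdE)
    have "real_of_int m = M * q" unfolding q M_def by simp
    then have a: "a = pi * q" using M by (simp add: a_def)
    have "cos (2 * real j * a) = 1" for j
      using cos_int_2pin[of "int j * q"] by (simp add: a mult_ac)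
    then have "?L = (\<Sum>j\<le>N'. if j = 0 then 1/2 else 1)"
      unfolding sum by simp
    also have "\<dots> = M / 2"
      by (simp add: M_def N' sum.atMost_shift del: sum.atMost_Suc)
    finally show ?thesis using True by (simp add: M_def)
  next
    case False
    have "sin a \<noteq> 0"
    proof
      assume "sin a = 0"
      then obtain q where "a = of_int q * pi" by (auto simp: sin_zero_iff_int2)
      then have "real_of_int m = real_of_int ((2 * int N - 1) * q)"
        using Ma by (simp add: M_def)
      then show False using False by (simp only: of_int_eq_iff) simp
    qed
    moreover have "sin ((2 * real N' + 1) * a) = 0"
      unfolding sin_zero_iff_int2 using Ma by (intro exI[of _ m]) (simp add: M_def N' algebra_simps)
    ultimately have "?L = 0"
      unfolding sum using dirichlet_kernel[of a N'] by simp
    then show ?thesis using False by (simp add: M_def)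
  qed
qed

text \<open>
  By the product formula the sum splits into \<open>sum_cos\<close> at \<open>k - k'\<close> and at \<open>k + k'\<close>. Both
  have absolute value less than \<open>2 N - 1\<close>, so divisibility means being zero; the second contributes
  only for \<open>k = k' = 0\<close>, which doubles the norm there.
\<close>

lemma sum_cos_cos:
  assumes k: "k \<in> {0..int N - 1}" and k': "k' \<in> {0..int N - 1}"
  shows "(\<Sum>r\<in>{0..int N - 1}. c N r * cos (2 * pi * k * r / (2 * real N - 1))
            * cos (2 * pi * k' * r / (2 * real N - 1))) =
    (if k = k' then (2 * real N - 1) / 4 / c N k else 0)" (is "?L = _")
proof -
  define M where "M = 2 * real N - 1"
  have "?L = (\<Sum>r\<in>{0..int N - 1}. (c N r * cos (2 * pi * (k - k') * r / M) +
      c N r * cos (2 * pi * (k + k') * r / M)) / 2)"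
    by (intro sum.cong refl)
      (simp add: cos_times_cos M_def mult.assoc ring_distribs add_divide_distrib diff_divide_distrib)
  also have "\<dots> = ((\<Sum>r\<in>{0..int N - 1}. c N r * cos (2 * pi * (k - k') * r / M)) +
      (\<Sum>r\<in>{0..int N - 1}. c N r * cos (2 * pi * (k + k') * r / M))) / 2"
    by (simp only: sum.distrib sum_divide_distrib add_divide_distrib)
  also have "\<dots> = ((if (2 * int N - 1) dvd (k - k') then M / 2 else 0) +
      (if (2 * int N - 1) dvd (k + k') then M / 2 else 0)) / 2"
    using sum_cos[of "k - k'"] sum_cos[of "k + k'"] by (simp add: M_def)
  also have "(2 * int N - 1) dvd (k - k') \<longleftrightarrow> k = k'"
    using k k' dvd_imp_le_int[of "k - k'" "2 * int N - 1"] by (cases "k = k'") auto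
  also have "(2 * int N - 1) dvd (k + k') \<longleftrightarrow> k = 0 \<and> k' = 0"
    using k k' zdvd_not_zless[of "k + k'" "2 * int N - 1"] by (cases "k = 0 \<and> k' = 0") auto
  finally show ?thesis using k by (auto simp: c_eq M_def)
qed

text \<open>The point with index \<open>N - 1 - b\<close> is \<open>1 - 2 b / (2 N - 1)\<close>.\<close>

lemma kern_reverse:
  "kern N a (int N - 1 - b) = (-1) powi a * cos (2 * pi * a * b / (2 * real N - 1))"
proof -
  define M where "M = 2 * real N - 1"
  have M: "M > 0" using N by (simp add: M_def)
  have "2 * (real_of_int (int N - 1 - b) + 1/2) / M = 1 - 2 * b / M"
    using M by (simp add: divide_simps) (simp add: M_def algebra_simps)
  then have "kern N a (int N - 1 - b) = cos (pi * a * (1 - 2 * b / M))"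
    unfolding kern_def M_def[symmetric] by (simp only:)
  also have "\<dots> = cos (pi * a - 2 * pi * a * b / M)"
    by (simp add: algebra_simps)
  also have "\<dots> = (-1) powi a * cos (2 * pi * a * b / M)"
    by (simp add: cos_diff power_int_minus_left)
  finally show ?thesis by (simp add: M_def)
qed

text \<open>
  After reversal both relations below become \<open>sum_cos_cos\<close>: the signs \<open>(-1)\<^sup>k\<close> square to one
  or leave the sum, and the weight \<open>c N\<close> of the last index \<open>r = N - 1\<close> equals the
  weight \<open>c 0\<close> of its mirror image.
\<close>

lemma kern_orthogonal_rows:
  assumes "k \<in> {0..int N - 1}" "k' \<in> {0..int N - 1}"
  shows "(\<Sum>r\<in>{0..int N - 1}. c N (r + 1) * kern N k r * kern N k' r) =
    (if k = k' then (2 * real N - 1) / 4 / c N k else 0)"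
proof -
  have "(\<Sum>r\<in>{0..int N - 1}. c N (r + 1) * kern N k r * kern N k' r) =
      (\<Sum>j\<in>{0..int N - 1}. c N j * kern N k (int N - 1 - j) * kern N k' (int N - 1 - j))"
    by (rule sum.reindex_bij_witness[of _ "\<lambda>j. int N - 1 - j" "\<lambda>j. int N - 1 - j"])
      (auto simp: c_def)
  also have "\<dots> = (-1) powi k * (-1) powi k' *
      (\<Sum>r\<in>{0..int N - 1}. c N r * cos (2 * pi * k * r / (2 * real N - 1))
            * cos (2 * pi * k' * r / (2 * real N - 1)))"
    by (simp add: kern_reverse sum_distrib_left mult_ac)
  finally show ?thesis
    by (simp add: sum_cos_cos[OF assms] flip: power_int_mult_distrib)
qed

lemma kern_orthogonal_columns:
  assumes r: "r \<in> {0..int N - 1}" and r': "r' \<in> {0..int N - 1}"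
  shows "(\<Sum>k\<in>{0..int N - 1}. c N k * kern N k r * kern N k r') =
    (if r = r' then (2 * real N - 1) / 4 / c N (r + 1) else 0)"
proof -
  define j j' where "j = int N - 1 - r" and "j' = int N - 1 - r'"
  have j: "j \<in> {0..int N - 1}" "j' \<in> {0..int N - 1}" and c: "c N (r + 1) = c N j"
    and eq: "j = j' \<longleftrightarrow> r = r'"
    using r r' by (auto simp: j_def j'_def c_def)
  have kern: "kern N k r * kern N k r' =
      cos (2 * pi * j * k / (2 * real N - 1)) * cos (2 * pi * j' * k / (2 * real N - 1))" for k
  proof -
    have "kern N k r * kern N k r' = ((-1) powi k * (-1) powi k) *
      (cos (2 * pi * j * k / (2 * real N - 1)) * cos (2 * pi * j' * k / (2 * real N - 1)))"
      using kern_reverse[of k j] kern_reverse[of k j'] by (simp add: j_def j'_def mult_ac)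
    then show ?thesis by (simp flip: power_int_mult_distrib)
  qed
  show ?thesis
    using sum_cos_cos[OF j] by (simp only: mult.assoc kern c eq)
qed

end

section \<open>Discrete orthogonality and expansion\<close>

lemma D_minus_eq: "D_minus n N = decr_tuples n {0..int N - 1}"
  by (simp add: D_minus_def D_def decr_tuples_def)

lemma cos_minus_grid_point:
  "cos_minus n (\<lambda>i. real_of_int (k i)) (grid_point n N r) = alt n (kern N) k r"
  unfolding cos_minus_def alt_def by (intro sum.cong refl) (simp add: grid_point_def kern_def)

lemma sum_F_VI_minus:
  "(\<Sum>s\<in>F_VI_minus n N. g s) = (\<Sum>r\<in>D_minus n N. g (grid_point n N r))"
  unfolding F_VI_minus_def by (simp add: sum.reindex[OF inj_on_grid_point])

theorem mainTheorem2:
  fixes n N :: nat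
  assumes "n \<ge> 1" and "N \<ge> 1"
  shows "(\<forall>k\<in>D_minus n N. \<forall>k'\<in>D_minus n N.
            (\<Sum>s\<in>F_VI_minus n N.
               eps_tilde n N s * cos_minus n (\<lambda>i. real_of_int (k i)) s
                 * cos_minus n (\<lambda>i. real_of_int (k' i)) s)
            = inverse (d n N k) * ((2 * real N - 1) / 4) ^ n * (if k = k' then 1 else 0))
       \<and> (\<forall>f :: (nat \<Rightarrow> real) \<Rightarrow> real.
            let A = (\<lambda>k. d n N k * (4 / (2 * real N - 1)) ^ n
                      * (\<Sum>s\<in>F_VI_minus n N.
                           eps_tilde n N s * f s * cos_minus n (\<lambda>i. real_of_int (k i)) s))
            in \<forall>s\<in>F_VI_minus n N.
                 f s = (\<Sum>k\<in>D_minus n N. A k * cos_minus n (\<lambda>i. real_of_int (k i)) s))"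
proof -
  let ?D = "D_minus n N"
  define M where "M = 2 * real N - 1"
  have M: "M > 0" using \<open>N \<ge> 1\<close> by (simp add: M_def)
  define C where "C k r = alt n (kern N) k r" for k r
  define \<epsilon> where "\<epsilon> r = (\<Prod>i=1..n. c N (r i + 1))" for r :: "nat \<Rightarrow> int"
  have \<epsilon>: "\<epsilon> r \<noteq> 0" for r by (simp add: \<epsilon>_def c_def)
  have fin: "finite ?D" by (simp add: D_minus_eq finite_decr_tuples)
  have rows: "(\<Sum>r\<in>?D. \<epsilon> r * C k r * C k' r) = (if k = k' then (M / 4) ^ n / d n N k else 0)"
    if "k \<in> ?D" "k' \<in> ?D" for k k'
    using alt_orthogonal[where T = "{0..int N - 1}", OF _ kern_orthogonal_rows[OF \<open>N \<ge> 1\<close>], where n = n and k = k and l = k'] that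
    by (simp add: D_minus_eq C_def \<epsilon>_def d_def M_def prod_dividef prod.distrib power_divide)
  have columns: "(\<Sum>k\<in>?D. d n N k * C k r * C k r') = (if r = r' then (M / 4) ^ n / \<epsilon> r else 0)"
    if "r \<in> ?D" "r' \<in> ?D" for r r'
    using alt_orthogonal[where \<phi> = "\<lambda>b a. kern N a b" and T = "{0..int N - 1}",
        OF _ kern_orthogonal_columns[OF \<open>N \<ge> 1\<close>], where n = n and k = r and l = r'] that
    by (simp add: D_minus_eq C_def alt_transpose[of n "kern N"] \<epsilon>_def d_def M_def prod_dividef prod.distrib power_divide)
  have expansion: "g r = (\<Sum>k\<in>?D. d n N k * (4 / M) ^ n * (\<Sum>r'\<in>?D. \<epsilon> r' * g r' * C k r') * C k r)"
    if r: "r \<in> ?D" for g r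
  proof -
    have "(\<Sum>k\<in>?D. d n N k * (4 / M) ^ n * (\<Sum>r'\<in>?D. \<epsilon> r' * g r' * C k r') * C k r) =
        (\<Sum>k\<in>?D. \<Sum>r'\<in>?D. (4 / M) ^ n * \<epsilon> r' * g r' * (d n N k * C k r' * C k r))"
      by (simp add: sum_distrib_left sum_distrib_right mult_ac)
    also have "\<dots> = (\<Sum>r'\<in>?D. (4 / M) ^ n * \<epsilon> r' * g r' * (\<Sum>k\<in>?D. d n N k * C k r' * C k r))"
      by (subst sum.swap) (simp add: sum_distrib_left)
    also have "\<dots> = (\<Sum>r'\<in>?D. if r' = r then (4 / M) ^ n * \<epsilon> r * g r * ((M / 4) ^ n / \<epsilon> r) else 0)"
      using r by (intro sum.cong refl) (simp add: columns)
    also have "\<dots> = ((4 / M) * (M / 4)) ^ n * g r"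
      using r fin \<epsilon>[of r] unfolding power_mult_distrib by (simp add: sum.delta')
    finally show ?thesis using M by simp
  qed
  have eps: "(\<Sum>r\<in>?D. eps_tilde n N (grid_point n N r) * g r) = (\<Sum>r\<in>?D. \<epsilon> r * g r)" for g
    by (intro sum.cong refl) (simp add: eps_tilde_grid_point \<epsilon>_def)
  show ?thesis
  proof (intro conjI ballI allI)
    fix k k' assume "k \<in> ?D" "k' \<in> ?D"
    then show "(\<Sum>s\<in>F_VI_minus n N. eps_tilde n N s * cos_minus n (\<lambda>i. real_of_int (k i)) s
          * cos_minus n (\<lambda>i. real_of_int (k' i)) s)
        = inverse (d n N k) * ((2 * real N - 1) / 4) ^ n * (if k = k' then 1 else 0)"
      using rows[of k k']
      unfolding sum_F_VI_minus cos_minus_grid_point eps mult.assoc C_def M_def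
      by (auto simp: field_simps)
  next
    fix f :: "(nat \<Rightarrow> real) \<Rightarrow> real"
    show "let A = (\<lambda>k. d n N k * (4 / (2 * real N - 1)) ^ n
                * (\<Sum>s\<in>F_VI_minus n N.
                     eps_tilde n N s * f s * cos_minus n (\<lambda>i. real_of_int (k i)) s))
      in \<forall>s\<in>F_VI_minus n N. f s = (\<Sum>k\<in>?D. A k * cos_minus n (\<lambda>i. real_of_int (k i)) s)"
      unfolding Let_def
    proof
      fix s assume "s \<in> F_VI_minus n N"
      then obtain r where r: "r \<in> ?D" and s: "s = grid_point n N r"
        by (auto simp: F_VI_minus_def)
      show "f s = (\<Sum>k\<in>?D. d n N k * (4 / (2 * real N - 1)) ^ n
                * (\<Sum>s\<in>F_VI_minus n N.
                     eps_tilde n N s * f s * cos_minus n (\<lambda>i. real_of_int (k i)) s)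
                * cos_minus n (\<lambda>i. real_of_int (k i)) s)"
        using expansion[OF r, of "\<lambda>r. f (grid_point n N r)"]
        unfolding s sum_F_VI_minus cos_minus_grid_point eps mult.assoc C_def M_def .
    qed
  qed
qed

end
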